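(* In the regression type model, suppose that the local estimators are $$\hat f_{n,jh}^{(k)}=\frac1n\sum_{i=1}^nh(X_i^{(k)})\psi_{jh}(T_i^{(k)}),\qquad 0\le j\le\log_2(N)/(1+2r),\ 0\le h\le2^j-1,\ k=1,\dots,m,$$ where the function $h(\cdot)$ satisfies 1. $\mathbb E[h(X)\mid T]=f(T)$; 2. for $q=\lceil3/r+6\rceil$, $\max_{t\in[0,1]}\mathbb E[|h(X)|^q\mid T=t]<\infty$ (uniformly over the class of $f$ considered). Then there exists $\sigma^2>0$ such that for all such $j,h,k$ (uniformly over the class of $f$ considered), $$\mathbb E_f[\hat f_{n,jh}^{(k)}]=f_{jh},\qquad\mathrm{var}(\hat f_{n,jh}^{(k)})\le\sigma^2/n,\qquad\mathbb P_f\big(|\hat f_{n,jh}^{(k)}|>\sqrt N\big)=o\big(m^{-1}N^{-(3+4r)/(1+2r)}\big).$$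
   Context: Regression type model: there are $m$ machines; machine $k$ observes $(T_i^{(k)},X_i^{(k)})$, $i=1,\dots,n$; all pairs are i.i.d. copies of $(T,X)$ with $T\sim\mathrm{Unif}[0,1]$ and $X\mid T\sim p_{X\mid T}(\cdot\mid f(T))$, $f\in B_{2,2}^r(L)$, $r,L>0$ fixed. $N=nm$ and asymptotics are as $n\to\infty$ with $m$ possibly depending on $n$. $\{\psi_{jh}: j\ge 0,\ 0\le h\le 2^j-1\}$ is the orthonormal basis of $L_2([0,1])$ of compactly supported boundary-corrected Daubechies wavelets with $S>r$ vanishing moments (scaling function(s) included at level $j=0$; in particular $\|\psi_{jh}\|_\infty\le C2^{j/2}$), $f_{jh}=\langle f,\psi_{jh}\rangle$, $\|f\|_{B^r_{2,2}}^2=\sum_j2^{2jr}\sum_hf_{jh}^2$ and $B_{2,2}^r(L)=\{f\in L_2([0,1]):\|f\|_{B_{2,2}^r}<L\}$. *)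

theory Defs
  imports "HOL-Probability.Probability"
begin

definition U01 :: "real measure" where
  "U01 = restrict_space lborel {0..1}"

definition L2_U01 :: "(real \<Rightarrow> real) set" where
  "L2_U01 = {f \<in> borel_measurable U01. integrable U01 (\<lambda>t. (f t)\<^sup>2)}"

definition orthonormal_basis_U01 :: "'i set \<Rightarrow> ('i \<Rightarrow> real \<Rightarrow> real) \<Rightarrow> bool" where
  "orthonormal_basis_U01 I e \<longleftrightarrow>
     (\<forall>i\<in>I. e i \<in> L2_U01) \<and>
     (\<forall>i\<in>I. \<forall>i'\<in>I. (\<integral>t. e i t * e i' t \<partial>U01) = (if i = i' then 1 else 0)) \<and>
     (\<forall>f\<in>L2_U01. \<forall>\<epsilon>>0. \<exists>A c. finite A \<and> A \<subseteq> I \<and>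
        (\<integral>t. (f t - (\<Sum>i\<in>A. c i * e i t))\<^sup>2 \<partial>U01) < \<epsilon>)"

(* Daubechies scaling function and wavelet on the real line, with S vanishing moments.
   The refinement mask has the minimal length 2 S; it is indexed so that both functions
   are supported in [1 - S, S].  The refinement equation determines the scaling function
   only up to null sets (apart from the normalisation); boundedness is therefore
   required explicitly, as it excludes unbounded versions. *)
definition daubechies_pair :: "nat \<Rightarrow> (real \<Rightarrow> real) \<Rightarrow> (real \<Rightarrow> real) \<Rightarrow> bool" where
  "daubechies_pair S \<phi> w \<longleftrightarrow>
     S \<ge> 1 \<and>
     \<phi> \<in> borel_measurable borel \<and> bounded (range \<phi>) \<and>
     (\<forall>x. x \<notin> {1 - real S..real S} \<longrightarrow> \<phi> x = 0) \<and>
     (\<integral>x. \<phi> x \<partial>lborel) = 1 \<and>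
     (\<exists>c :: int \<Rightarrow> real.
        (\<forall>k. k \<notin> {1 - int S..int S} \<longrightarrow> c k = 0) \<and>
        (\<Sum>k=1 - int S..int S. c k) = sqrt 2 \<and>
        (\<forall>l. (\<Sum>k=1 - int S..int S. c k * c (k + 2 * l)) = (if l = 0 then 1 else 0)) \<and>
        (\<forall>p<S. (\<Sum>k=1 - int S..int S.
            (if even k then 1 else - 1) * real_of_int k ^ p * c k) = 0) \<and>
        (\<forall>x. \<phi> x = sqrt 2 * (\<Sum>k=1 - int S..int S. c k * \<phi> (2 * x - real_of_int k))) \<and>
        (\<forall>x. w x = sqrt 2 * (\<Sum>k=1 - int S..int S.
            (if even k then 1 else - 1) * c (1 - k) * \<phi> (2 * x - real_of_int k))))"

(* Cohen-Daubechies-Vial edge functions: linear combinations of translates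
   x \<mapsto> \<phi> (s x - k), k \<in> A, cut off at the end point (here 0) of a half line.
   Take s = 1 for scaling functions and s = 2 for wavelets. *)
definition left_edge :: "(real \<Rightarrow> real) \<Rightarrow> real \<Rightarrow> int set \<Rightarrow> (int \<Rightarrow> real) \<Rightarrow> real \<Rightarrow> real" where
  "left_edge \<phi> s A a x = (if 0 \<le> x then \<Sum>k\<in>A. a k * \<phi> (s * x - real_of_int k) else 0)"

definition right_edge :: "(real \<Rightarrow> real) \<Rightarrow> real \<Rightarrow> int set \<Rightarrow> (int \<Rightarrow> real) \<Rightarrow> real \<Rightarrow> real" where
  "right_edge \<phi> s A a x = (if x \<le> 0 then \<Sum>k\<in>A. a k * \<phi> (s * x - real_of_int k) else 0)"

(* The 2^j functions of resolution 2^-j on [0,1]: S left edge functions,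
   2^j - 2 S interior dilates and translates of g, and S right edge functions. *)
definition interval_level ::
  "nat \<Rightarrow> (nat \<Rightarrow> real \<Rightarrow> real) \<Rightarrow> (real \<Rightarrow> real) \<Rightarrow> (nat \<Rightarrow> real \<Rightarrow> real)
    \<Rightarrow> nat \<Rightarrow> nat \<Rightarrow> real \<Rightarrow> real" where
  "interval_level S gl g gr j l t = 2 powr (real j / 2) *
     (if l < S then gl l (2 ^ j * t)
      else if l < 2 ^ j - S then g (2 ^ j * t - real l)
      else gr (l - (2 ^ j - S)) (2 ^ j * t - 2 ^ j))"

(* J is the coarsest resolution of the construction, 2^J \<ge> 2 S (so that the two edges
   do not interact).  The 2^J scaling functions form level 0, the wavelets of
   resolution 2^-j form level j for j \<ge> J, and the levels in between are empty. *)
definition level_size :: "nat \<Rightarrow> nat \<Rightarrow> nat" where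
  "level_size J j = (if j = 0 then 2 ^ J else if j < J then 0 else 2 ^ j)"

(* The index sets of the edge functions are those translates whose support meets the
   half line and which do not lie in the span of the interior scaling functions
   (and interior wavelets, for s = 2). *)
definition boundary_daubechies_basis :: "nat \<Rightarrow> nat \<Rightarrow> (nat \<Rightarrow> nat \<Rightarrow> real \<Rightarrow> real) \<Rightarrow> bool" where
  "boundary_daubechies_basis S J \<psi> \<longleftrightarrow>
     2 * S \<le> 2 ^ J \<and>
     (\<exists>\<phi> w a a' b b'.
        daubechies_pair S \<phi> w \<and>
        (\<forall>l<2 ^ J. \<psi> 0 l = interval_level S
            (\<lambda>i. left_edge \<phi> 1 {1 - int S..int S - 1} (a i)) \<phi>
            (\<lambda>i. right_edge \<phi> 1 {- int S..int S - 2} (a' i)) J l) \<and>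
        (\<forall>j\<ge>J. \<forall>l<2 ^ j. \<psi> j l = interval_level S
            (\<lambda>i. left_edge \<phi> 2 {1 - int S..3 * int S - 2} (b i)) w
            (\<lambda>i. right_edge \<phi> 2 {1 - 3 * int S..int S - 2} (b' i)) j l)) \<and>
     (\<forall>j\<ge>J. \<forall>l<2 ^ j. \<forall>p<S. (\<integral>t. t ^ p * \<psi> j l t \<partial>U01) = 0) \<and>
     orthonormal_basis_U01 {(j, l). l < level_size J j} (\<lambda>(j, l). \<psi> j l)"

definition wcoeff :: "(nat \<Rightarrow> nat \<Rightarrow> real \<Rightarrow> real) \<Rightarrow> (real \<Rightarrow> real) \<Rightarrow> nat \<Rightarrow> nat \<Rightarrow> real" where
  "wcoeff \<psi> f j l = (\<integral>t. f t * \<psi> j l t \<partial>U01)"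

definition besov_term ::
  "nat \<Rightarrow> (nat \<Rightarrow> nat \<Rightarrow> real \<Rightarrow> real) \<Rightarrow> real \<Rightarrow> (real \<Rightarrow> real) \<Rightarrow> nat \<Rightarrow> real" where
  "besov_term J \<psi> r f j = 2 powr (2 * real j * r) * (\<Sum>l<level_size J j. (wcoeff \<psi> f j l)\<^sup>2)"

definition besov_ball ::
  "nat \<Rightarrow> (nat \<Rightarrow> nat \<Rightarrow> real \<Rightarrow> real) \<Rightarrow> real \<Rightarrow> real \<Rightarrow> (real \<Rightarrow> real) set" where
  "besov_ball J \<psi> r L = {f \<in> L2_U01. summable (besov_term J \<psi> r f) \<and>
     sqrt (\<Sum>j. besov_term J \<psi> r f j) < L}"

(* Joint law of (T, X) when T is uniform on [0,1] and X given T = t has law K (f t). *)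
definition obs_law :: "'x measure \<Rightarrow> (real \<Rightarrow> 'x measure) \<Rightarrow> (real \<Rightarrow> real) \<Rightarrow> (real \<times> 'x) measure" where
  "obs_law MX K f = U01 \<bind> (\<lambda>t. distr (K (f t)) (U01 \<Otimes>\<^sub>M MX) (Pair t))"

(* The sub-sigma-algebra generated by T. *)
definition sigma_T :: "(real \<times> 'x) measure \<Rightarrow> (real \<times> 'x) measure" where
  "sigma_T P = vimage_algebra (space P) fst U01"

definition sample_law ::
  "'x measure \<Rightarrow> (real \<Rightarrow> 'x measure) \<Rightarrow> (real \<Rightarrow> real) \<Rightarrow> nat \<Rightarrow> nat
    \<Rightarrow> (nat \<times> nat \<Rightarrow> real \<times> 'x) measure" where
  "sample_law MX K f m n = PiM ({1..m} \<times> {1..n}) (\<lambda>_. obs_law MX K f)"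

(* The observation of index i on machine k is the coordinate (k, i) of \<omega>. *)
definition local_est ::
  "('x \<Rightarrow> real) \<Rightarrow> (nat \<Rightarrow> nat \<Rightarrow> real \<Rightarrow> real) \<Rightarrow> nat \<Rightarrow> nat \<Rightarrow> nat \<Rightarrow> nat
    \<Rightarrow> (nat \<times> nat \<Rightarrow> real \<times> 'x) \<Rightarrow> real" where
  "local_est h \<psi> n k j l \<omega> =
     (1 / real n) * (\<Sum>i=1..n. h (snd (\<omega> (k, i))) * \<psi> j l (fst (\<omega> (k, i))))"

definition est_index :: "nat \<Rightarrow> real \<Rightarrow> nat \<Rightarrow> nat \<Rightarrow> (nat \<times> nat \<times> nat) set" where
  "est_index J r m n = {(k, j, l). k \<in> {1..m} \<and>
     real j \<le> log 2 (real (n * m)) / (1 + 2 * r) \<and> l < level_size J j}"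

end

theory Submission
  imports Defs
begin

text \<open>
  A local estimator is the mean of the \<open>n\<close> independent copies of
  \<open>Z = h(X) \<psi>(T)\<close> held by one machine, where \<open>\<psi>\<close> abbreviates \<open>\<psi> j l\<close>.  Everything rests on
  one remark: conditioning on \<open>T\<close> replaces a power of \<open>h(X)\<close> by its conditional moment,
  and what remains is an integral of \<open>\<psi>\<close> over the design interval, because \<open>T\<close> is
  uniform.

  Write \<open>q = \<lceil>3/r + 6\<rceil>\<close>, and let \<open>B\<close> bound the conditional \<open>q\<close>-th absolute moment of
  \<open>h(X)\<close>.  The conditional mean hypothesis turns \<open>E Z\<close> into the wavelet coefficient.  Since
  \<open>h\<^sup>2 \<le> 1 + \<bar>h\<bar>\<^sup>q\<close> and \<open>\<psi>\<close> has norm one, \<open>E Z\<^sup>2 \<le> 1 + B\<close>, and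
  independence gives the variance bound with \<open>\<sigma>\<^sup>2 = 1 + B\<close>.

  For the tail, convexity of the \<open>q\<close>-th power and Markov's inequality bound the probability
  by \<open>E \<bar>Z\<bar>\<^sup>q / N\<^bsup>q/2\<^esup>\<close>.  All factors of \<open>\<bar>\<psi>\<bar>\<^sup>q\<close> but two are
  estimated by the sup norm, which is at most \<open>C 2\<^bsup>j/2\<^esup>\<close>
  (\<open>boundary_daubechies_basis_sup_bound\<close>); the other two integrate to one.  So
  \<open>E \<bar>Z\<bar>\<^sup>q \<le> B (C 2\<^bsup>j/2\<^esup>)\<^bsup>q-2\<^esup>\<close>
  (\<open>observation_power_moment_le\<close>).  As \<open>2\<^sup>j \<le> N\<^bsup>1/(1+2r)\<^esup>\<close>, the probability is at most a
  constant times \<open>N\<close> to the power \<open>-(qr+1)/(1+2r)\<close>, and \<open>q \<ge> 3/r + 6\<close> says precisely that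
  this exponent is at most \<open>-1 - (3+4r)/(1+2r)\<close> (\<open>moment_tail_rate\<close>).  Equality is possible, so
  no power of \<open>N\<close> is left over to make the bound of smaller order.  The gain comes from
  \<open>1/N = (1/n) (1/m)\<close>: beyond the required rate there is a factor \<open>1/n\<close>, which tends to zero
  uniformly in \<open>m\<close>.
\<close>

section \<open>Sup norm of boundary-corrected wavelets\<close>

lemma sum_translates_bounded:
  fixes g :: "real \<Rightarrow> real"
  assumes "\<And>x. \<bar>g x\<bar> \<le> C"
  shows "\<bar>\<Sum>k\<in>A. a k * g (s * x - real_of_int k)\<bar> \<le> (\<Sum>k\<in>A. \<bar>a k\<bar> * C)"
  by (intro order_trans[OF sum_abs] sum_mono) (simp add: abs_mult assms mult_left_mono)

lemma left_edge_bounded: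
  assumes "\<And>x. \<bar>\<phi> x\<bar> \<le> C"
  shows "\<exists>c. \<forall>x. \<bar>left_edge \<phi> s A a x\<bar> \<le> c"
proof (intro exI allI)
  fix x
  have "0 \<le> C" using assms[of 0] by linarith
  then show "\<bar>left_edge \<phi> s A a x\<bar> \<le> (\<Sum>k\<in>A. \<bar>a k\<bar> * C)"
    unfolding left_edge_def
    using sum_translates_bounded[of \<phi> C a s x A, OF assms] by (auto intro: sum_nonneg)
qed

lemma right_edge_bounded:
  assumes "\<And>x. \<bar>\<phi> x\<bar> \<le> C"
  shows "\<exists>c. \<forall>x. \<bar>right_edge \<phi> s A a x\<bar> \<le> c"
proof (intro exI allI)
  fix x
  have "0 \<le> C" using assms[of 0] by linarith
  then show "\<bar>right_edge \<phi> s A a x\<bar> \<le> (\<Sum>k\<in>A. \<bar>a k\<bar> * C)"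
    unfolding right_edge_def
    using sum_translates_bounded[of \<phi> C a s x A, OF assms] by (auto intro: sum_nonneg)
qed

lemma daubechies_pair_bounded:
  assumes "daubechies_pair S \<phi> w"
  shows "\<exists>C. \<forall>x. \<bar>\<phi> x\<bar> \<le> C \<and> \<bar>w x\<bar> \<le> C"
proof -
  from assms obtain C where C: "\<And>x. \<bar>\<phi> x\<bar> \<le> C"
    unfolding daubechies_pair_def bounded_iff by auto
  from assms obtain c :: "int \<Rightarrow> real" where
    w: "\<And>x. w x = sqrt 2 * (\<Sum>k=1 - int S..int S.
            (if even k then 1 else - 1) * c (1 - k) * \<phi> (2 * x - real_of_int k))"
    unfolding daubechies_pair_def by blast
  define a :: "int \<Rightarrow> real" where "a k = (if even k then 1 else - 1) * c (1 - k)" for k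
  define D where "D = sqrt 2 * (\<Sum>k=1 - int S..int S. \<bar>a k\<bar> * C)"
  have D: "\<bar>w x\<bar> \<le> D" for x
    unfolding w D_def abs_mult a_def[symmetric]
    using sum_translates_bounded[of \<phi> C a 2 x "{1 - int S..int S}", OF C]
    by (simp add: mult_left_mono)
  have "\<forall>x. \<bar>\<phi> x\<bar> \<le> max C D \<and> \<bar>w x\<bar> \<le> max C D"
    using C D by (simp add: le_max_iff_disj)
  then show ?thesis ..
qed

text \<open>
  A level uses only \<open>2 S + 1\<close> different profiles, whatever its resolution, so one constant serves
  all levels once the normalising factor is taken out.
\<close>

lemma interval_level_bounded:
  assumes gl: "\<And>i. \<exists>c. \<forall>x. \<bar>gl i x\<bar> \<le> c" and g: "\<And>x. \<bar>g x\<bar> \<le> c"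
    and gr: "\<And>i. \<exists>c. \<forall>x. \<bar>gr i x\<bar> \<le> c"
  shows "\<exists>C\<ge>0. \<forall>j l t. 2 * S \<le> 2 ^ j \<longrightarrow> l < 2 ^ j \<longrightarrow>
           \<bar>interval_level S gl g gr j l t\<bar> \<le> C * 2 powr (real j / 2)"
proof -
  from gl gr obtain cl cr where cl: "\<And>i x. \<bar>gl i x\<bar> \<le> cl i" and cr: "\<And>i x. \<bar>gr i x\<bar> \<le> cr i"
    by metis
  have nonneg: "0 \<le> cl i" "0 \<le> cr i" "0 \<le> c" for i
    using cl[of i 0] cr[of i 0] g[of 0] by linarith+
  define C where "C = (\<Sum>i<S. cl i) + c + (\<Sum>i<S. cr i)"
  have sums: "0 \<le> (\<Sum>i<S. cl i)" "0 \<le> (\<Sum>i<S. cr i)"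
    using nonneg by (auto intro: sum_nonneg)
  have le_C: "cl i \<le> C" "cr i \<le> C" if "i < S" for i
  proof -
    have "cl i \<le> (\<Sum>i<S. cl i)" "cr i \<le> (\<Sum>i<S. cr i)"
      using that nonneg by (auto intro!: member_le_sum)
    then show "cl i \<le> C" "cr i \<le> C" unfolding C_def using sums nonneg by linarith+
  qed
  have "c \<le> C" unfolding C_def using sums by linarith
  show ?thesis
  proof (intro exI conjI allI impI)
    show "0 \<le> C" using \<open>c \<le> C\<close> nonneg by linarith
    fix j l :: nat and t :: real
    assume S: "2 * S \<le> 2 ^ j" and l: "l < 2 ^ j"
    have "\<bar>gl l (2 ^ j * t)\<bar> \<le> C" if "l < S"
      using cl[of l "2 ^ j * t"] le_C(1)[OF that] by linarith
    moreover have "\<bar>g (2 ^ j * t - real l)\<bar> \<le> C"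
      using g[of "2 ^ j * t - real l"] \<open>c \<le> C\<close> by linarith
    moreover have "\<bar>gr (l - (2 ^ j - S)) (2 ^ j * t - 2 ^ j)\<bar> \<le> C" if "\<not> l < 2 ^ j - S"
    proof -
      have "l - (2 ^ j - S) < S" using that S l by auto
      then show ?thesis
        using cr[of "l - (2 ^ j - S)" "2 ^ j * t - 2 ^ j"] le_C(2)[of "l - (2 ^ j - S)"] by linarith
    qed
    ultimately have "\<bar>if l < S then gl l (2 ^ j * t)
           else if l < 2 ^ j - S then g (2 ^ j * t - real l)
           else gr (l - (2 ^ j - S)) (2 ^ j * t - 2 ^ j)\<bar> \<le> C"
      by simp
    then show "\<bar>interval_level S gl g gr j l t\<bar> \<le> C * 2 powr (real j / 2)"
      unfolding interval_level_def abs_mult by (simp add: mult.commute mult_right_mono)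
  qed
qed

text \<open>
  Level 0 holds the scaling functions of resolution \<open>J\<close>, so their factor \<open>2\<^bsup>J/2\<^esup>\<close> is
  absorbed into the constant.
\<close>

lemma boundary_daubechies_basis_sup_bound:
  assumes "boundary_daubechies_basis S J \<psi>"
  obtains C where "C > 0"
    and "\<And>j l t. l < level_size J j \<Longrightarrow> \<bar>\<psi> j l t\<bar> \<le> C * 2 powr (real j / 2)"
proof -
  from assms obtain \<phi> w a a' b b' where
    J: "2 * S \<le> 2 ^ J" and pair: "daubechies_pair S \<phi> w" and
    scal: "\<And>l. l < 2 ^ J \<Longrightarrow> \<psi> 0 l = interval_level S
            (\<lambda>i. left_edge \<phi> 1 {1 - int S..int S - 1} (a i)) \<phi>
            (\<lambda>i. right_edge \<phi> 1 {- int S..int S - 2} (a' i)) J l" and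
    wav: "\<And>j l. J \<le> j \<Longrightarrow> l < 2 ^ j \<Longrightarrow> \<psi> j l = interval_level S
            (\<lambda>i. left_edge \<phi> 2 {1 - int S..3 * int S - 2} (b i)) w
            (\<lambda>i. right_edge \<phi> 2 {1 - 3 * int S..int S - 2} (b' i)) j l"
    unfolding boundary_daubechies_basis_def by auto
  from pair obtain c where \<phi>: "\<And>x. \<bar>\<phi> x\<bar> \<le> c" and w: "\<And>x. \<bar>w x\<bar> \<le> c"
    using daubechies_pair_bounded by blast
  have left: "\<exists>c. \<forall>x. \<bar>left_edge \<phi> s A u x\<bar> \<le> c"
    and right: "\<exists>c. \<forall>x. \<bar>right_edge \<phi> s A u x\<bar> \<le> c" for s A u
    by (rule left_edge_bounded right_edge_bounded, rule \<phi>)+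
  obtain C0 where "C0 \<ge> 0" and C0: "\<forall>j l t. 2 * S \<le> 2 ^ j \<longrightarrow> l < 2 ^ j \<longrightarrow>
      \<bar>interval_level S
            (\<lambda>i. left_edge \<phi> 1 {1 - int S..int S - 1} (a i)) \<phi>
            (\<lambda>i. right_edge \<phi> 1 {- int S..int S - 2} (a' i)) j l t\<bar> \<le> C0 * 2 powr (real j / 2)"
    using interval_level_bounded[of "\<lambda>i. left_edge \<phi> 1 {1 - int S..int S - 1} (a i)" \<phi> c
        "\<lambda>i. right_edge \<phi> 1 {- int S..int S - 2} (a' i)" S, OF left \<phi> right] by blast
  obtain C1 where "C1 \<ge> 0" and C1: "\<forall>j l t. 2 * S \<le> 2 ^ j \<longrightarrow> l < 2 ^ j \<longrightarrow>
      \<bar>interval_level S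
            (\<lambda>i. left_edge \<phi> 2 {1 - int S..3 * int S - 2} (b i)) w
            (\<lambda>i. right_edge \<phi> 2 {1 - 3 * int S..int S - 2} (b' i)) j l t\<bar>
        \<le> C1 * 2 powr (real j / 2)"
    using interval_level_bounded[of "\<lambda>i. left_edge \<phi> 2 {1 - int S..3 * int S - 2} (b i)" w c
        "\<lambda>i. right_edge \<phi> 2 {1 - 3 * int S..int S - 2} (b' i)" S, OF left w right] by blast
  \<comment> \<open>the summand 1 makes \<open>C\<close> positive, whatever the edge coefficients are\<close>
  define C where "C = 1 + C0 * 2 powr (real J / 2) + C1"
  have C: "1 \<le> C" "C0 * 2 powr (real J / 2) \<le> C" "C1 \<le> C"
    using \<open>C0 \<ge> 0\<close> \<open>C1 \<ge> 0\<close> by (auto simp: C_def)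
  show thesis
  proof (rule that)
    show "0 < C" using C by linarith
    fix j l t
    assume l: "l < level_size J j"
    consider "j = 0" | "0 < j" "J \<le> j" using l by (auto simp: level_size_def split: if_splits)
    then show "\<bar>\<psi> j l t\<bar> \<le> C * 2 powr (real j / 2)"
    proof cases
      case 1
      then have "\<bar>\<psi> j l t\<bar> \<le> C0 * 2 powr (real J / 2)"
        using C0[rule_format, OF J, of l t] scal[of l] l by (simp add: level_size_def)
      then show ?thesis using C 1 by simp
    next
      case 2
      then have "l < 2 ^ j" using l by (simp add: level_size_def)
      moreover have "2 * S \<le> 2 ^ j"
        using J power_increasing[OF \<open>J \<le> j\<close>, of "2::nat"] by linarith
      ultimately have "\<bar>\<psi> j l t\<bar> \<le> C1 * 2 powr (real j / 2)"
        using C1[rule_format] wav[OF \<open>J \<le> j\<close>] by simp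
      also have "\<dots> \<le> C * 2 powr (real j / 2)" using C by (intro mult_right_mono) auto
      finally show ?thesis .
    qed
  qed
qed

lemma boundary_daubechies_basis_normalised:
  assumes "boundary_daubechies_basis S J \<psi>" "l < level_size J j"
  shows "\<psi> j l \<in> L2_U01" and "(\<integral>t. (\<psi> j l t)\<^sup>2 \<partial>U01) = 1"
  using assms unfolding boundary_daubechies_basis_def orthonormal_basis_U01_def
  by (auto simp: power2_eq_square)

section \<open>Means of i.i.d. coordinates\<close>

text \<open>Jensen's inequality for the uniform distribution on \<open>A\<close>.\<close>

lemma abs_mean_power_le:
  fixes y :: "'a \<Rightarrow> real"
  assumes "finite A" "A \<noteq> {}"
  shows "\<bar>(\<Sum>a\<in>A. y a) / real (card A)\<bar> ^ q \<le> (\<Sum>a\<in>A. \<bar>y a\<bar> ^ q) / real (card A)"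
proof -
  have convex: "convex_on {0::real..} (\<lambda>x. x ^ q)"
  proof (cases "even q")
    case True
    then show ?thesis by (rule convex_on_subset[OF convex_power_even]) auto
  qed (rule convex_power_odd)
  have "\<bar>(\<Sum>a\<in>A. y a) / real (card A)\<bar> \<le> (\<Sum>a\<in>A. (1 / real (card A)) *\<^sub>R \<bar>y a\<bar>)"
    by (simp add: sum_divide_distrib[symmetric] divide_right_mono sum_abs)
  then have "\<bar>(\<Sum>a\<in>A. y a) / real (card A)\<bar> ^ q \<le> (\<Sum>a\<in>A. (1 / real (card A)) *\<^sub>R \<bar>y a\<bar>) ^ q"
    by (rule power_mono) simp
  also have "\<dots> \<le> (\<Sum>a\<in>A. (1 / real (card A)) * \<bar>y a\<bar> ^ q)"
    using assms by (intro convex_on_sum[OF _ _ convex]) auto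
  finally show ?thesis by (simp add: sum_divide_distrib)
qed

lemma
  fixes g :: "'a \<Rightarrow> real"
  assumes Q: "prob_space Q" and a: "a \<in> I" and g: "integrable Q g"
  shows integrable_PiM_coordinate: "integrable (PiM I (\<lambda>_. Q)) (\<lambda>\<omega>. g (\<omega> a))"
    and integral_PiM_coordinate: "(\<integral>\<omega>. g (\<omega> a) \<partial>PiM I (\<lambda>_. Q)) = (\<integral>x. g x \<partial>Q)"
proof -
  have D: "distr (PiM I (\<lambda>_. Q)) Q (\<lambda>\<omega>. \<omega> a) = Q"
    using distr_PiM_component[of I "\<lambda>_. Q" a] Q a by auto
  have m: "(\<lambda>\<omega>. \<omega> a) \<in> PiM I (\<lambda>_. Q) \<rightarrow>\<^sub>M Q" using a by (rule measurable_component_singleton)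
  from g show "integrable (PiM I (\<lambda>_. Q)) (\<lambda>\<omega>. g (\<omega> a))"
    using integrable_distr[OF m, of g] by (simp add: D)
  from g show "(\<integral>\<omega>. g (\<omega> a) \<partial>PiM I (\<lambda>_. Q)) = (\<integral>x. g x \<partial>Q)"
    using integral_distr[OF m, of g] by (simp add: D)
qed

text \<open>
  Independence in the form that variances require.  The product of two coordinates is a
  product over all of \<open>I\<close> with the other factors equal to one, so Fubini's theorem for
  finite products applies directly.
\<close>

lemma
  fixes g :: "'a \<Rightarrow> real"
  assumes Q: "prob_space Q" and I: "finite I" "a \<in> I" "b \<in> I" "a \<noteq> b" and g: "integrable Q g"
  shows integrable_PiM_coordinate_mult: "integrable (PiM I (\<lambda>_. Q)) (\<lambda>\<omega>. g (\<omega> a) * g (\<omega> b))"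
    and integral_PiM_coordinate_mult:
      "(\<integral>\<omega>. g (\<omega> a) * g (\<omega> b) \<partial>PiM I (\<lambda>_. Q)) = (\<integral>x. g x \<partial>Q)\<^sup>2"
proof -
  interpret Q: prob_space Q by (rule Q)
  interpret product_sigma_finite "\<lambda>_. Q" by unfold_locales
  define u where "u i = (if i = a \<or> i = b then g else (\<lambda>_. 1))" for i
  have u: "integrable Q (u i)" for i using g by (auto simp: u_def)
  have pick: "(\<Prod>i\<in>I. F i) = F a * F b" if "\<And>i. i \<in> I - {a, b} \<Longrightarrow> F i = 1" for F :: "_ \<Rightarrow> real"
  proof -
    have "(\<Prod>i\<in>I. F i) = (\<Prod>i\<in>{a, b}. F i)" using I that by (intro prod.mono_neutral_right) auto
    then show ?thesis using I by simp
  qed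
  have "(\<lambda>\<omega>. \<Prod>i\<in>I. u i (\<omega> i)) = (\<lambda>\<omega>. g (\<omega> a) * g (\<omega> b))"
    by (rule ext, subst pick) (auto simp: u_def)
  moreover have "(\<Prod>i\<in>I. \<integral>x. u i x \<partial>Q) = (\<integral>x. g x \<partial>Q)\<^sup>2"
    by (subst pick) (auto simp: u_def power2_eq_square Q.prob_space)
  ultimately show "integrable (PiM I (\<lambda>_. Q)) (\<lambda>\<omega>. g (\<omega> a) * g (\<omega> b))"
    "(\<integral>\<omega>. g (\<omega> a) * g (\<omega> b) \<partial>PiM I (\<lambda>_. Q)) = (\<integral>x. g x \<partial>Q)\<^sup>2"
    using product_integrable_prod[OF I(1), of u] product_integral_prod[OF I(1), of u] u by simp_all
qed

text \<open>
  The centred square expands into a double sum over \<open>A\<close> in which the off-diagonal terms have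
  expectation zero.  Bounding the variance of \<open>g\<close> by its second moment is enough for a
  rate of one over the sample size.
\<close>

lemma
  fixes g :: "'a \<Rightarrow> real"
  assumes Q: "prob_space Q" and I: "finite I" and A: "A \<subseteq> I" "A \<noteq> {}"
    and g: "integrable Q g" and g2: "integrable Q (\<lambda>x. (g x)\<^sup>2)"
  defines "mean \<equiv> \<lambda>\<omega>. (\<Sum>a\<in>A. g (\<omega> a)) / real (card A)"
  shows integrable_PiM_mean: "integrable (PiM I (\<lambda>_. Q)) mean"
    and integrable_PiM_mean_square: "integrable (PiM I (\<lambda>_. Q)) (\<lambda>\<omega>. (mean \<omega>)\<^sup>2)"
    and expectation_PiM_mean: "prob_space.expectation (PiM I (\<lambda>_. Q)) mean = (\<integral>x. g x \<partial>Q)"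
    and variance_PiM_mean_le:
      "prob_space.variance (PiM I (\<lambda>_. Q)) mean \<le> (\<integral>x. (g x)\<^sup>2 \<partial>Q) / real (card A)"
proof -
  let ?P = "PiM I (\<lambda>_. Q)"
  interpret Q: prob_space Q by (rule Q)
  interpret P: prob_space ?P by (intro prob_space_PiM Q)
  have fin: "finite A" using I A finite_subset by blast
  define n where "n = real (card A)"
  have n: "n > 0" using fin A by (simp add: n_def card_gt_0_iff)
  define \<mu> where "\<mu> = (\<integral>x. g x \<partial>Q)"
  define g0 where "g0 x = g x - \<mu>" for x
  have coord: "integrable ?P (\<lambda>\<omega>. g (\<omega> a))" "(\<integral>\<omega>. g (\<omega> a) \<partial>?P) = \<mu>" if "a \<in> A" for a
    using integrable_PiM_coordinate[OF Q subsetD[OF A(1) that] g]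
      integral_PiM_coordinate[OF Q subsetD[OF A(1) that] g]
    by (simp_all add: \<mu>_def)
  show int_mean: "integrable ?P mean"
    unfolding mean_def by (intro Bochner_Integration.integrable_divide Bochner_Integration.integrable_sum coord)
  show exp_mean: "P.expectation mean = (\<integral>x. g x \<partial>Q)"
    unfolding mean_def using coord n by (simp add: \<mu>_def n_def)
  have g0: "integrable Q g0" "(\<integral>x. g0 x \<partial>Q) = 0"
    using g unfolding g0_def by (auto simp: \<mu>_def Q.prob_space)
  have g02: "integrable Q (\<lambda>x. (g0 x)\<^sup>2)"
    unfolding g0_def power2_diff using g g2 by (auto intro!: Bochner_Integration.integrable_diff Bochner_Integration.integrable_add)
  have cross: "integrable ?P (\<lambda>\<omega>. g0 (\<omega> a) * g0 (\<omega> b))"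
    "(\<integral>\<omega>. g0 (\<omega> a) * g0 (\<omega> b) \<partial>?P) = (if a = b then \<integral>x. (g0 x)\<^sup>2 \<partial>Q else 0)"
    if "a \<in> A" "b \<in> A" for a b
  proof -
    have ab: "a \<in> I" "b \<in> I" using that A by auto
    show "integrable ?P (\<lambda>\<omega>. g0 (\<omega> a) * g0 (\<omega> b))"
      using integrable_PiM_coordinate_mult[OF Q I ab _ g0(1)]
        integrable_PiM_coordinate[OF Q ab(1) g02]
      by (cases "a = b") (auto simp: power2_eq_square)
    show "(\<integral>\<omega>. g0 (\<omega> a) * g0 (\<omega> b) \<partial>?P) = (if a = b then \<integral>x. (g0 x)\<^sup>2 \<partial>Q else 0)"
      using integral_PiM_coordinate_mult[OF Q I ab _ g0(1)]
        integral_PiM_coordinate[OF Q ab(1) g02] g0(2)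
      by (cases "a = b") (auto simp: power2_eq_square)
  qed
  have centred: "(mean \<omega> - \<mu>)\<^sup>2 = (\<Sum>a\<in>A. \<Sum>b\<in>A. g0 (\<omega> a) * g0 (\<omega> b)) / n\<^sup>2" for \<omega>
  proof -
    have "mean \<omega> - \<mu> = (\<Sum>a\<in>A. g0 (\<omega> a)) / n"
      unfolding mean_def g0_def using n by (simp add: sum_subtractf n_def field_simps)
    then show ?thesis by (simp add: power_divide power2_eq_square sum_product)
  qed
  have int_c: "integrable ?P (\<lambda>\<omega>. (mean \<omega> - \<mu>)\<^sup>2)"
    unfolding centred by (intro Bochner_Integration.integrable_divide Bochner_Integration.integrable_sum cross)
  have "integrable ?P (\<lambda>\<omega>. (mean \<omega> - \<mu>)\<^sup>2 + 2 * \<mu> * mean \<omega> - \<mu>\<^sup>2)"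
    using int_c int_mean by (auto intro!: Bochner_Integration.integrable_diff Bochner_Integration.integrable_add)
  then show "integrable ?P (\<lambda>\<omega>. (mean \<omega>)\<^sup>2)"
    by (simp add: power2_diff algebra_simps)
  have "P.variance mean = (\<integral>\<omega>. (mean \<omega> - \<mu>)\<^sup>2 \<partial>?P)"
    unfolding exp_mean \<mu>_def ..
  also have "\<dots> = (\<Sum>a\<in>A. \<Sum>b\<in>A. \<integral>\<omega>. g0 (\<omega> a) * g0 (\<omega> b) \<partial>?P) / n\<^sup>2"
    unfolding centred using cross by (simp add: Bochner_Integration.integrable_sum)
  also have "\<dots> = (\<Sum>a\<in>A. \<Sum>b\<in>A. if a = b then \<integral>x. (g0 x)\<^sup>2 \<partial>Q else 0) / n\<^sup>2"
    using cross by simp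
  also have "\<dots> = (\<integral>x. (g0 x)\<^sup>2 \<partial>Q) / n"
    using fin n by (simp add: n_def power2_eq_square)
  also have "(\<integral>x. (g0 x)\<^sup>2 \<partial>Q) = (\<integral>x. (g x)\<^sup>2 \<partial>Q) - \<mu>\<^sup>2"
    unfolding g0_def \<mu>_def using g g2 by (rule Q.variance_eq)
  also have "((\<integral>x. (g x)\<^sup>2 \<partial>Q) - \<mu>\<^sup>2) / n \<le> (\<integral>x. (g x)\<^sup>2 \<partial>Q) / n"
    using n by (intro divide_right_mono) auto
  finally show "P.variance mean \<le> (\<integral>x. (g x)\<^sup>2 \<partial>Q) / real (card A)"
    by (simp add: n_def)
qed

text \<open>
  Markov's inequality is applied to the mean of the \<open>q\<close>-th powers, which dominates the \<open>q\<close>-th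
  power of the mean and has the same expectation as a single term.
\<close>

lemma PiM_mean_tail_le:
  fixes g :: "'a \<Rightarrow> real"
  assumes Q: "prob_space Q" and I: "finite I" and A: "A \<subseteq> I" "A \<noteq> {}"
    and gq: "integrable Q (\<lambda>x. \<bar>g x\<bar> ^ q)" and c: "c > 0"
  shows "measure (PiM I (\<lambda>_. Q))
      {\<omega> \<in> space (PiM I (\<lambda>_. Q)). \<bar>(\<Sum>a\<in>A. g (\<omega> a)) / real (card A)\<bar> > c}
    \<le> (\<integral>x. \<bar>g x\<bar> ^ q \<partial>Q) / c ^ q"
proof -
  let ?P = "PiM I (\<lambda>_. Q)"
  interpret P: prob_space ?P by (intro prob_space_PiM Q)
  have fin: "finite A" using I A finite_subset by blast
  define M where "M \<omega> = (\<Sum>a\<in>A. \<bar>g (\<omega> a)\<bar> ^ q) / real (card A)" for \<omega>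
  have coord: "integrable ?P (\<lambda>\<omega>. \<bar>g (\<omega> a)\<bar> ^ q)"
    "(\<integral>\<omega>. \<bar>g (\<omega> a)\<bar> ^ q \<partial>?P) = (\<integral>x. \<bar>g x\<bar> ^ q \<partial>Q)" if "a \<in> A" for a
    using integrable_PiM_coordinate[OF Q subsetD[OF A(1) that] gq]
      integral_PiM_coordinate[OF Q subsetD[OF A(1) that] gq] by simp_all
  have M: "integrable ?P M"
    unfolding M_def by (intro Bochner_Integration.integrable_divide Bochner_Integration.integrable_sum coord)
  have M_int: "(\<integral>\<omega>. M \<omega> \<partial>?P) = (\<integral>x. \<bar>g x\<bar> ^ q \<partial>Q)"
    unfolding M_def using coord fin A by simp
  have "measure ?P {\<omega> \<in> space ?P. \<bar>(\<Sum>a\<in>A. g (\<omega> a)) / real (card A)\<bar> > c}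
      \<le> measure ?P {\<omega> \<in> space ?P. M \<omega> \<ge> c ^ q}"
  proof (rule P.finite_measure_mono)
    show "{\<omega> \<in> space ?P. M \<omega> \<ge> c ^ q} \<in> sets ?P"
      using borel_measurable_integrable[OF M] by measurable
    have "c ^ q \<le> M \<omega>" if "\<bar>(\<Sum>a\<in>A. g (\<omega> a)) / real (card A)\<bar> > c" for \<omega>
    proof -
      have "c ^ q \<le> \<bar>(\<Sum>a\<in>A. g (\<omega> a)) / real (card A)\<bar> ^ q"
        using c that by (intro power_mono) auto
      also have "\<dots> \<le> M \<omega>" unfolding M_def using fin A by (intro abs_mean_power_le)
      finally show ?thesis .
    qed
    then show "{\<omega> \<in> space ?P. \<bar>(\<Sum>a\<in>A. g (\<omega> a)) / real (card A)\<bar> > c}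
      \<subseteq> {\<omega> \<in> space ?P. M \<omega> \<ge> c ^ q}" by auto
  qed
  also have "\<dots> \<le> (\<integral>\<omega>. M \<omega> \<partial>?P) / c ^ q"
  proof (rule integral_Markov_inequality_measure[OF M, where A = "space ?P"])
    show "AE \<omega> in ?P. 0 \<le> M \<omega>" by (simp add: M_def sum_nonneg)
  qed (use c in simp_all)
  finally show ?thesis by (simp add: M_int)
qed

section \<open>The law of one observation\<close>

lemma space_U01 [simp]: "space U01 = {0..1}"
  by (simp add: U01_def space_restrict_space)

lemma prob_space_U01: "prob_space U01"
  by (rule prob_spaceI) (simp add: U01_def emeasure_restrict_space space_restrict_space)

text \<open>
  Later arguments use the joint law only through these three facts.  The last one holds because
  projecting the conditional law back to the first coordinate leaves a point mass at the design
  point.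
\<close>

lemma obs_law_properties:
  assumes K: "K \<in> borel \<rightarrow>\<^sub>M prob_algebra MX" and f: "f \<in> borel_measurable U01"
  shows prob_space_obs_law: "prob_space (obs_law MX K f)"
    and sets_obs_law: "sets (obs_law MX K f) = sets (U01 \<Otimes>\<^sub>M MX)"
    and distr_obs_law_fst: "distr (obs_law MX K f) U01 fst = U01"
proof -
  interpret U: prob_space U01 by (rule prob_space_U01)
  let ?N = "\<lambda>t. distr (K (f t)) (U01 \<Otimes>\<^sub>M MX) (Pair t)"
  have Kf: "(\<lambda>t. K (f t)) \<in> U01 \<rightarrow>\<^sub>M prob_algebra MX"
    using measurable_compose[OF f K] .
  have N: "?N \<in> U01 \<rightarrow>\<^sub>M prob_algebra (U01 \<Otimes>\<^sub>M MX)"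
    by (rule measurable_distr_prob_space2[OF Kf]) simp
  note N' = measurable_prob_algebraD[OF N]
  have prob_N: "prob_space (?N t)" "sets (?N t) = sets (U01 \<Otimes>\<^sub>M MX)" if "t \<in> space U01" for t
    using measurable_space[OF N that] by (simp_all add: space_prob_algebra)
  have K_t: "sets (K (f t)) = sets MX" "prob_space (K (f t))" if "t \<in> space U01" for t
    using measurable_space[OF Kf that] by (simp_all add: space_prob_algebra)
  show "prob_space (obs_law MX K f)"
    unfolding obs_law_def by (rule U.prob_space_bind[OF _ N']) (use prob_N in auto)
  show "sets (obs_law MX K f) = sets (U01 \<Otimes>\<^sub>M MX)"
    unfolding obs_law_def by (rule sets_bind) (use prob_N in auto)
  have "distr (obs_law MX K f) U01 fst = U01 \<bind> (\<lambda>t. distr (?N t) U01 fst)"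
    unfolding obs_law_def by (rule distr_bind[OF N']) auto
  also have "\<dots> = U01 \<bind> return U01"
  proof (rule bind_cong[OF refl])
    fix t assume t: "t \<in> space U01"
    have Pt: "Pair t \<in> K (f t) \<rightarrow>\<^sub>M U01 \<Otimes>\<^sub>M MX"
      using measurable_Pair1'[OF t, of MX] K_t(1)[OF t] by (simp cong: measurable_cong_sets)
    have "distr (?N t) U01 fst = distr (K (f t)) U01 (\<lambda>_. t)"
      using Pt by (subst distr_distr) (auto simp: comp_def)
    also have "\<dots> = return U01 t"
      using prob_space.distr_const[OF K_t(2)[OF t] t] .
    finally show "distr (?N t) U01 fst = return U01 t" .
  qed
  also have "\<dots> = U01" by (rule bind_return')
  finally show "distr (obs_law MX K f) U01 fst = U01" .
qed

lemma measurable_fst_obs_law: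
  assumes "sets P = sets (U01 \<Otimes>\<^sub>M MX)"
  shows "fst \<in> P \<rightarrow>\<^sub>M U01"
  using measurable_fst measurable_cong_sets[OF assms refl] by blast

lemma measurable_snd_obs_law:
  assumes "sets P = sets (U01 \<Otimes>\<^sub>M MX)"
  shows "snd \<in> P \<rightarrow>\<^sub>M MX"
  using measurable_snd measurable_cong_sets[OF assms refl] by blast

lemma finite_measure_subalgebra_sigma_T:
  assumes P: "prob_space P" and fst: "fst \<in> P \<rightarrow>\<^sub>M U01"
  shows "finite_measure_subalgebra P (sigma_T P)"
proof -
  interpret prob_space P by (rule P)
  show ?thesis
  proof
    show "subalgebra P (sigma_T P)"
      unfolding subalgebra_def sigma_T_def
      using measurable_sets[OF fst] measurable_space[OF fst]
      by (auto simp: sets_vimage_algebra2)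
  qed
qed

lemma measurable_sigma_T:
  assumes fst: "fst \<in> P \<rightarrow>\<^sub>M U01" and u: "u \<in> U01 \<rightarrow>\<^sub>M N"
  shows "(\<lambda>z. u (fst z)) \<in> sigma_T P \<rightarrow>\<^sub>M N"
proof -
  have "fst \<in> sigma_T P \<rightarrow>\<^sub>M U01"
    unfolding sigma_T_def
    by (rule measurable_vimage_algebra1) (use measurable_space[OF fst] in auto)
  then show ?thesis using u by (rule measurable_compose)
qed

text \<open>
  A weight that depends on the design point only is measurable for the conditioning algebra, so it
  can be integrated against the conditional expectation; the latter is bounded, and the weight is
  then integrated over the uniform design.
\<close>

lemma design_weighted_moment_le:
  fixes u :: "real \<Rightarrow> ennreal" and G :: "'x \<Rightarrow> ennreal"
  assumes P: "prob_space P" "sets P = sets (U01 \<Otimes>\<^sub>M MX)" "distr P U01 fst = U01"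
    and G: "G \<in> borel_measurable MX" and u: "u \<in> borel_measurable U01"
    and bound: "AE z in P. nn_cond_exp P (sigma_T P) (\<lambda>z. G (snd z)) z \<le> B"
  shows "(\<integral>\<^sup>+z. u (fst z) * G (snd z) \<partial>P) \<le> (\<integral>\<^sup>+t. u t \<partial>U01) * B"
proof -
  note fst = measurable_fst_obs_law[OF P(2)] and snd = measurable_snd_obs_law[OF P(2)]
  interpret finite_measure_subalgebra P "sigma_T P"
    by (rule finite_measure_subalgebra_sigma_T[OF P(1) fst])
  have "(\<integral>\<^sup>+z. u (fst z) * G (snd z) \<partial>P)
      = (\<integral>\<^sup>+z. u (fst z) * nn_cond_exp P (sigma_T P) (\<lambda>z. G (snd z)) z \<partial>P)"
    using measurable_sigma_T[OF fst u] measurable_compose[OF snd G]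
    by (rule nn_cond_exp_intg[symmetric])
  also have "\<dots> \<le> (\<integral>\<^sup>+z. u (fst z) * B \<partial>P)"
    using bound by (intro nn_integral_mono_AE) (auto elim!: eventually_mono intro: mult_left_mono)
  also have "\<dots> = (\<integral>\<^sup>+z. u (fst z) \<partial>P) * B"
    using measurable_compose[OF fst u] by (rule nn_integral_multc)
  also have "(\<integral>\<^sup>+z. u (fst z) \<partial>P) = (\<integral>\<^sup>+t. u t \<partial>distr P U01 fst)"
    using fst u by (simp add: nn_integral_distr)
  finally show ?thesis by (simp add: P(3))
qed

lemma square_le_one_plus_power:
  fixes x :: real
  assumes "2 \<le> q"
  shows "x\<^sup>2 \<le> 1 + \<bar>x\<bar> ^ q"
proof (cases "\<bar>x\<bar> \<le> 1")
  case True
  then have "\<bar>x\<bar>\<^sup>2 \<le> 1" by (intro power_le_one) auto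
  then show ?thesis by (simp add: add_increasing2)
next
  case False
  then have "\<bar>x\<bar>\<^sup>2 \<le> \<bar>x\<bar> ^ q" using assms by (intro power_increasing) auto
  then show ?thesis by simp
qed

text \<open>
  All moments of one summary \<open>Z\<close> are controlled by the single variable
  \<open>W = u(T)\<^sup>2 \<bar>h(X)\<bar>\<^sup>q\<close>, whose expectation is at most \<open>B\<close> since \<open>u\<close> has norm one.
  Keeping exactly two factors of \<open>u\<close> inside the integral is what gives \<open>M\<^bsup>q-2\<^esup>\<close> and not
  \<open>M\<^sup>q\<close>, and the tail rate depends on this saving.
\<close>

lemma
  fixes u f :: "real \<Rightarrow> real" and h :: "'x \<Rightarrow> real" and B M :: real
  assumes P: "prob_space P" "sets P = sets (U01 \<Otimes>\<^sub>M MX)" "distr P U01 fst = U01"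
    and h: "h \<in> borel_measurable MX" and f: "f \<in> borel_measurable U01"
    and u: "u \<in> L2_U01" and u_norm: "(\<integral>t. (u t)\<^sup>2 \<partial>U01) = 1"
    and q: "2 \<le> q" and B: "0 \<le> B"
    and moment: "AE z in P. nn_cond_exp P (sigma_T P) (\<lambda>z. ennreal (\<bar>h (snd z)\<bar> ^ q)) z \<le> ennreal B"
  defines "Z \<equiv> \<lambda>z. h (snd z) * u (fst z)"
  shows integrable_observation: "integrable P Z"
    and integrable_observation_square: "integrable P (\<lambda>z. (Z z)\<^sup>2)"
    and observation_second_moment_le: "(\<integral>z. (Z z)\<^sup>2 \<partial>P) \<le> 1 + B"
    and observation_mean:
      "(AE z in P. real_cond_exp P (sigma_T P) (\<lambda>z. h (snd z)) z = f (fst z)) \<Longrightarrow>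
         (\<integral>z. Z z \<partial>P) = (\<integral>t. f t * u t \<partial>U01)"
    and integrable_observation_power:
      "(\<And>t. \<bar>u t\<bar> \<le> M) \<Longrightarrow> integrable P (\<lambda>z. \<bar>Z z\<bar> ^ q)"
    and observation_power_moment_le:
      "(\<And>t. \<bar>u t\<bar> \<le> M) \<Longrightarrow> (\<integral>z. \<bar>Z z\<bar> ^ q \<partial>P) \<le> B * M ^ (q - 2)"
proof -
  interpret P: prob_space P by (rule P(1))
  note fst = measurable_fst_obs_law[OF P(2)] and snd = measurable_snd_obs_law[OF P(2)]
  interpret C: finite_measure_subalgebra P "sigma_T P"
    by (rule finite_measure_subalgebra_sigma_T[OF P(1) fst])
  have u_meas: "u \<in> borel_measurable U01" and u2: "integrable U01 (\<lambda>t. (u t)\<^sup>2)"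
    using u by (auto simp: L2_U01_def)
  note [measurable] = measurable_compose[OF snd h] measurable_compose[OF fst u_meas]
    measurable_compose[OF fst f]
  have Z_meas [measurable]: "Z \<in> borel_measurable P" unfolding Z_def by measurable
  define W where "W z = (u (fst z))\<^sup>2 * \<bar>h (snd z)\<bar> ^ q" for z
  have W_meas [measurable]: "W \<in> borel_measurable P" unfolding W_def by measurable
  have W_nonneg: "0 \<le> W z" for z by (simp add: W_def)
  have "(\<integral>\<^sup>+z. ennreal (W z) \<partial>P)
      = (\<integral>\<^sup>+z. ennreal ((u (fst z))\<^sup>2) * ennreal (\<bar>h (snd z)\<bar> ^ q) \<partial>P)"
    by (simp add: W_def ennreal_mult)
  also have "\<dots> \<le> (\<integral>\<^sup>+t. ennreal ((u t)\<^sup>2) \<partial>U01) * ennreal B"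
    by (rule design_weighted_moment_le[OF P _ _ moment]) (use h u_meas in measurable)
  also have "(\<integral>\<^sup>+t. ennreal ((u t)\<^sup>2) \<partial>U01) = 1"
    using u2 u_norm by (subst nn_integral_eq_integral) auto
  finally have W_nn: "(\<integral>\<^sup>+z. ennreal (W z) \<partial>P) \<le> ennreal B" by simp
  have W_int: "integrable P W"
    using W_nn W_nonneg by (intro integrableI_bounded) (auto intro: le_less_trans)
  have "ennreal (\<integral>z. W z \<partial>P) \<le> ennreal B"
    using W_nn nn_integral_eq_integral[OF W_int] W_nonneg by simp
  then have W_le: "(\<integral>z. W z \<partial>P) \<le> B" using B by simp
  have uT: "integrable P (\<lambda>z. (u (fst z))\<^sup>2)" "(\<integral>z. (u (fst z))\<^sup>2 \<partial>P) = 1"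
    using integrable_distr[OF fst, of "\<lambda>t. (u t)\<^sup>2"] integral_distr[OF fst, of "\<lambda>t. (u t)\<^sup>2"]
      u2 u_meas u_norm by (simp_all add: P(3))
  have Z2_le: "(Z z)\<^sup>2 \<le> (u (fst z))\<^sup>2 + W z" for z
  proof -
    have "(u (fst z))\<^sup>2 * (h (snd z))\<^sup>2 \<le> (u (fst z))\<^sup>2 * (1 + \<bar>h (snd z)\<bar> ^ q)"
      by (intro mult_left_mono square_le_one_plus_power q) simp
    then show ?thesis by (simp add: Z_def W_def power_mult_distrib algebra_simps)
  qed
  show Z2: "integrable P (\<lambda>z. (Z z)\<^sup>2)"
  proof (rule Bochner_Integration.integrable_bound)
    show "integrable P (\<lambda>z. (u (fst z))\<^sup>2 + W z)" using uT W_int by simp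
    show "AE z in P. norm ((Z z)\<^sup>2) \<le> norm ((u (fst z))\<^sup>2 + W z)"
      using Z2_le W_nonneg by simp
  qed simp
  have "(\<integral>z. (Z z)\<^sup>2 \<partial>P) \<le> (\<integral>z. (u (fst z))\<^sup>2 + W z \<partial>P)"
    using Z2 uT W_int Z2_le by (intro integral_mono) auto
  also have "\<dots> = 1 + (\<integral>z. W z \<partial>P)" using uT W_int by simp
  finally show "(\<integral>z. (Z z)\<^sup>2 \<partial>P) \<le> 1 + B" using W_le by linarith
  show Z: "integrable P Z"
    using Z_meas Z2 by (rule P.square_integrable_imp_integrable)
  show "(\<integral>z. Z z \<partial>P) = (\<integral>t. f t * u t \<partial>U01)"
    if mean: "AE z in P. real_cond_exp P (sigma_T P) (\<lambda>z. h (snd z)) z = f (fst z)"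
  proof -
    have "(\<integral>z. Z z \<partial>P) = (\<integral>z. u (fst z) * h (snd z) \<partial>P)"
      by (simp add: Z_def mult.commute)
    also have "\<dots> = (\<integral>z. u (fst z) * real_cond_exp P (sigma_T P) (\<lambda>z. h (snd z)) z \<partial>P)"
      using Z measurable_sigma_T[OF fst u_meas] measurable_compose[OF snd h]
      by (intro C.real_cond_exp_intg(2)[symmetric]) (simp_all add: Z_def mult.commute)
    also have "\<dots> = (\<integral>z. f (fst z) * u (fst z) \<partial>P)"
      using mean by (intro integral_cong_AE) (auto simp: mult.commute)
    also have "\<dots> = (\<integral>t. f t * u t \<partial>distr P U01 fst)"
      using f u_meas by (intro integral_distr[OF fst, symmetric]) measurable
    finally show ?thesis by (simp add: P(3))
  qed
  have Zq_le: "\<bar>Z z\<bar> ^ q \<le> W z * M ^ (q - 2)" if M: "\<And>t. \<bar>u t\<bar> \<le> M" for z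
  proof -
    have "\<bar>u (fst z)\<bar> ^ q = (u (fst z))\<^sup>2 * \<bar>u (fst z)\<bar> ^ (q - 2)"
      using q by (metis le_add_diff_inverse power2_abs power_add)
    then have "\<bar>Z z\<bar> ^ q = W z * \<bar>u (fst z)\<bar> ^ (q - 2)"
      by (simp add: Z_def W_def abs_mult power_mult_distrib)
    also have "\<dots> \<le> W z * M ^ (q - 2)"
      using M W_nonneg by (intro mult_left_mono power_mono) auto
    finally show ?thesis .
  qed
  show Zq: "integrable P (\<lambda>z. \<bar>Z z\<bar> ^ q)" if M: "\<And>t. \<bar>u t\<bar> \<le> M"
  proof (rule Bochner_Integration.integrable_bound)
    show "integrable P (\<lambda>z. W z * M ^ (q - 2))" using W_int by simp
    show "AE z in P. norm (\<bar>Z z\<bar> ^ q) \<le> norm (W z * M ^ (q - 2))"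
      using Zq_le[OF M] by (intro AE_I2) (simp add: order_trans[OF _ abs_ge_self])
  qed simp
  show "(\<integral>z. \<bar>Z z\<bar> ^ q \<partial>P) \<le> B * M ^ (q - 2)" if M: "\<And>t. \<bar>u t\<bar> \<le> M"
  proof -
    have "0 \<le> M" using M[of 0] by linarith
    have "(\<integral>z. \<bar>Z z\<bar> ^ q \<partial>P) \<le> (\<integral>z. W z * M ^ (q - 2) \<partial>P)"
      using Zq[OF M] W_int Zq_le[OF M] by (intro integral_mono) auto
    also have "\<dots> = (\<integral>z. W z \<partial>P) * M ^ (q - 2)" by simp
    also have "\<dots> \<le> B * M ^ (q - 2)" using W_le \<open>0 \<le> M\<close> by (intro mult_right_mono) auto
    finally show ?thesis .
  qed
qed

section \<open>Rates\<close>

lemma resolution_le: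
  assumes r: "0 < r" and N: "1 \<le> N" and j: "real j \<le> log 2 N / (1 + 2 * r)"
  shows "2 powr (real j / 2) \<le> N powr (1 / (2 * (1 + 2 * r)))"
proof -
  have "2 powr (real j / 2) \<le> 2 powr (log 2 N * (1 / (2 * (1 + 2 * r))))"
    using j r by (intro powr_mono) (auto simp: field_simps)
  also have "\<dots> = N powr (1 / (2 * (1 + 2 * r)))"
    using N by (simp only: powr_powr[symmetric]) simp
  finally show ?thesis .
qed

text \<open>
  The left side is at most \<open>N\<close> to the power \<open>(q - 2) / (2 (1 + 2 r)) - q / 2\<close>, which equals
  \<open>-(q r + 1) / (1 + 2 r)\<close>; the right side has the exponent \<open>-(4 + 6 r) / (1 + 2 r)\<close>.  So the
  claim is \<open>q r \<ge> 3 + 6 r\<close>, which is where the number of moments comes from.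
\<close>

lemma moment_tail_rate:
  fixes r N x :: real and q :: nat
  assumes r: "0 < r" and N: "1 \<le> N" and q: "3 / r + 6 \<le> real q"
    and x: "0 \<le> x" "x \<le> N powr (1 / (2 * (1 + 2 * r)))"
  shows "x ^ (q - 2) / sqrt N ^ q \<le> 1 / N * N powr (- ((3 + 4 * r) / (1 + 2 * r)))"
proof -
  have "0 < 3 / r" using r by simp
  then have q2: "2 \<le> q" using q by linarith
  have "sqrt N = N powr (1 / 2)" using N by (simp add: powr_half_sqrt)
  then have sqrt_power: "sqrt N ^ q = N powr (real q / 2)"
    using N by (simp only: powr_power) simp
  have "x ^ (q - 2) \<le> (N powr (1 / (2 * (1 + 2 * r)))) ^ (q - 2)"
    using x by (intro power_mono)
  also have "\<dots> = N powr ((real q - 2) / (2 * (1 + 2 * r)))"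
    using N q2 by (simp add: powr_power of_nat_diff)
  finally have "x ^ (q - 2) / sqrt N ^ q
      \<le> N powr ((real q - 2) / (2 * (1 + 2 * r))) / sqrt N ^ q"
    using N by (intro divide_right_mono) auto
  also have "N powr ((real q - 2) / (2 * (1 + 2 * r))) / sqrt N ^ q
      = N powr (- ((real q * r + 1) / (1 + 2 * r)))"
    unfolding sqrt_power powr_diff[symmetric]
    using r by (intro arg_cong[where f = "(powr) N"]) (simp add: field_simps)
  also have "\<dots> \<le> N powr (- 1 + - ((3 + 4 * r) / (1 + 2 * r)))"
  proof (rule powr_mono[OF _ N])
    have "(3 / r + 6) * r \<le> real q * r" using q r by (intro mult_right_mono) auto
    then have "3 + 6 * r \<le> real q * r" using r by (simp add: distrib_right)
    then have "(4 + 6 * r) / (1 + 2 * r) \<le> (real q * r + 1) / (1 + 2 * r)"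
      using r by (intro divide_right_mono) auto
    moreover have "1 + (3 + 4 * r) / (1 + 2 * r) = (4 + 6 * r) / (1 + 2 * r)"
      using r by (simp add: field_simps)
    ultimately show "- ((real q * r + 1) / (1 + 2 * r)) \<le> - 1 + - ((3 + 4 * r) / (1 + 2 * r))"
      by linarith
  qed
  also have "\<dots> = 1 / N * N powr (- ((3 + 4 * r) / (1 + 2 * r)))"
    using N by (simp only: powr_add powr_minus) (simp add: field_simps powr_minus)
  finally show ?thesis .
qed

section \<open>The local estimators\<close>

lemma local_est_eq_mean:
  "local_est h \<psi> n k j l = (\<lambda>\<omega>. (\<Sum>a\<in>Pair k ` {1..n}. h (snd (\<omega> a)) * \<psi> j l (fst (\<omega> a)))
     / real (card (Pair k ` {1..n})))"
  by (rule ext) (simp add: local_est_def sum.reindex card_image inj_on_def)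

theorem lemma2:
  fixes r L :: real and S J :: nat
    and \<psi> :: "nat \<Rightarrow> nat \<Rightarrow> real \<Rightarrow> real"
    and MX :: "'x measure" and K :: "real \<Rightarrow> 'x measure"
    and \<F> :: "(real \<Rightarrow> real) set" and h :: "'x \<Rightarrow> real"
  assumes r_pos: "0 < r" and L_pos: "0 < L"
    and basis: "boundary_daubechies_basis S J \<psi>" and S_gt: "r < real S"
    and kernel: "K \<in> borel \<rightarrow>\<^sub>M prob_algebra MX"
    and f_class: "\<F> \<subseteq> besov_ball J \<psi> r L"
    and h_meas: "h \<in> borel_measurable MX"
    and cond_mean: "\<forall>f\<in>\<F>. AE z in obs_law MX K f.
      real_cond_exp (obs_law MX K f) (sigma_T (obs_law MX K f)) (\<lambda>z. h (snd z)) z = f (fst z)"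
    and cond_moment: "\<exists>B::real. \<forall>f\<in>\<F>. AE z in obs_law MX K f.
      nn_cond_exp (obs_law MX K f) (sigma_T (obs_law MX K f))
        (\<lambda>z. ennreal (\<bar>h (snd z)\<bar> ^ nat \<lceil>3 / r + 6\<rceil>)) z \<le> ennreal B"
  shows "\<exists>\<sigma>2>0. \<forall>m :: nat \<Rightarrow> nat. (\<forall>n. 1 \<le> m n) \<longrightarrow>
    (\<forall>n\<ge>1. \<forall>f\<in>\<F>. \<forall>(k, j, l) \<in> est_index J r (m n) n.
       integrable (sample_law MX K f (m n) n) (local_est h \<psi> n k j l) \<and>
       integrable (sample_law MX K f (m n) n) (\<lambda>\<omega>. (local_est h \<psi> n k j l \<omega>)\<^sup>2) \<and>
       prob_space.expectation (sample_law MX K f (m n) n) (local_est h \<psi> n k j l)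
         = wcoeff \<psi> f j l \<and>
       prob_space.variance (sample_law MX K f (m n) n) (local_est h \<psi> n k j l)
         \<le> \<sigma>2 / real n) \<and>
    (\<forall>\<epsilon>>0. \<forall>\<^sub>F n in sequentially. \<forall>f\<in>\<F>. \<forall>(k, j, l) \<in> est_index J r (m n) n.
       measure (sample_law MX K f (m n) n)
         {\<omega> \<in> space (sample_law MX K f (m n) n).
            \<bar>local_est h \<psi> n k j l \<omega>\<bar> > sqrt (real (n * m n))}
       \<le> \<epsilon> * (1 / real (m n) * real (n * m n) powr (- ((3 + 4 * r) / (1 + 2 * r)))))"
proof -
  define q where "q = nat \<lceil>3 / r + 6\<rceil>"
  have q: "3 / r + 6 \<le> real q" unfolding q_def by (rule real_nat_ceiling_ge)
  have "0 < 3 / r" using r_pos by simp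
  then have q2: "2 \<le> q" using q by linarith
  obtain B0 where B0: "\<And>f. f \<in> \<F> \<Longrightarrow> AE z in obs_law MX K f.
      nn_cond_exp (obs_law MX K f) (sigma_T (obs_law MX K f))
        (\<lambda>z. ennreal (\<bar>h (snd z)\<bar> ^ q)) z \<le> ennreal B0"
    using cond_moment unfolding q_def by blast
  \<comment> \<open>a negative \<open>B0\<close> has \<open>ennreal B0 = 0\<close>, so its positive part is a bound as well\<close>
  define B where "B = max 0 B0"
  have B: "0 \<le> B" "ennreal B0 \<le> ennreal B" by (auto simp: B_def intro: ennreal_leI)
  obtain C where "C > 0"
    and C: "\<And>j l t. l < level_size J j \<Longrightarrow> \<bar>\<psi> j l t\<bar> \<le> C * 2 powr (real j / 2)"
    using boundary_daubechies_basis_sup_bound[OF basis] by blast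
  define D where "D = B * C ^ (q - 2)"
  have D: "0 \<le> D" using B \<open>C > 0\<close> by (simp add: D_def)

  have main: "integrable (sample_law MX K f m n) (local_est h \<psi> n k j l) \<and>
       integrable (sample_law MX K f m n) (\<lambda>\<omega>. (local_est h \<psi> n k j l \<omega>)\<^sup>2) \<and>
       prob_space.expectation (sample_law MX K f m n) (local_est h \<psi> n k j l)
         = wcoeff \<psi> f j l \<and>
       prob_space.variance (sample_law MX K f m n) (local_est h \<psi> n k j l)
         \<le> (1 + B) / real n"
    and tail: "measure (sample_law MX K f m n)
         {\<omega> \<in> space (sample_law MX K f m n).
            \<bar>local_est h \<psi> n k j l \<omega>\<bar> > sqrt (real (n * m))}
       \<le> D / real n * (1 / real m * real (n * m) powr (- ((3 + 4 * r) / (1 + 2 * r))))"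
    if m: "1 \<le> m" and n: "1 \<le> n" and f: "f \<in> \<F>" and idx: "(k, j, l) \<in> est_index J r m n"
    for m n f k j l
  proof -
    let ?P = "obs_law MX K f" and ?I = "{1..m} \<times> {1..n}" and ?A = "Pair k ` {1..n}"
    let ?Z = "\<lambda>z. h (snd z) * \<psi> j l (fst z)"
    have k: "k \<in> {1..m}" and j: "real j \<le> log 2 (real (n * m)) / (1 + 2 * r)"
      and l: "l < level_size J j"
      using idx by (auto simp: est_index_def)
    have f_meas: "f \<in> borel_measurable U01"
      using f f_class by (auto simp: besov_ball_def L2_U01_def)
    note P = obs_law_properties[OF kernel f_meas]
    note \<psi> = boundary_daubechies_basis_normalised[OF basis l]
    have moment: "AE z in ?P. nn_cond_exp ?P (sigma_T ?P)
        (\<lambda>z. ennreal (\<bar>h (snd z)\<bar> ^ q)) z \<le> ennreal B"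
      using B0[OF f] B(2) by (auto elim!: eventually_mono intro: order_trans)
    note obs = P h_meas f_meas \<psi> q2 B(1) moment
    have A: "finite ?I" "?A \<subseteq> ?I" "?A \<noteq> {}" "card ?A = n"
      using k n by (auto simp: card_image inj_on_def)
    note Z = integrable_observation[OF obs] and Z2 = integrable_observation_square[OF obs]
    have "(\<integral>z. (?Z z)\<^sup>2 \<partial>?P) / real n \<le> (1 + B) / real n"
      using observation_second_moment_le[OF obs] by (intro divide_right_mono) auto
    then show "integrable (sample_law MX K f m n) (local_est h \<psi> n k j l) \<and>
       integrable (sample_law MX K f m n) (\<lambda>\<omega>. (local_est h \<psi> n k j l \<omega>)\<^sup>2) \<and>
       prob_space.expectation (sample_law MX K f m n) (local_est h \<psi> n k j l)
         = wcoeff \<psi> f j l \<and>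
       prob_space.variance (sample_law MX K f m n) (local_est h \<psi> n k j l)
         \<le> (1 + B) / real n"
      using integrable_PiM_mean[OF P(1) A(1-3) Z Z2] integrable_PiM_mean_square[OF P(1) A(1-3) Z Z2]
        expectation_PiM_mean[OF P(1) A(1-3) Z Z2] variance_PiM_mean_le[OF P(1) A(1-3) Z Z2]
        observation_mean[OF obs] cond_mean f
      unfolding local_est_eq_mean sample_law_def wcoeff_def A(4) by auto
    let ?N = "real (n * m)" and ?M = "C * 2 powr (real j / 2)"
    have N: "1 \<le> ?N" using m n by (simp add: mult_ge1_I del: of_nat_mult)
    have "measure (sample_law MX K f m n)
         {\<omega> \<in> space (sample_law MX K f m n). \<bar>local_est h \<psi> n k j l \<omega>\<bar> > sqrt ?N}
       \<le> (\<integral>z. \<bar>?Z z\<bar> ^ q \<partial>?P) / sqrt ?N ^ q"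
      unfolding local_est_eq_mean sample_law_def
      using N integrable_observation_power[OF obs C[OF l]]
      by (intro PiM_mean_tail_le[OF P(1) A(1-3)]) auto
    also have "\<dots> \<le> B * ?M ^ (q - 2) / sqrt ?N ^ q"
      using observation_power_moment_le[OF obs C[OF l]] by (intro divide_right_mono) auto
    also have "\<dots> = D * ((2 powr (real j / 2)) ^ (q - 2) / sqrt ?N ^ q)"
      by (simp add: D_def power_mult_distrib)
    also have "\<dots> \<le> D * (1 / ?N * ?N powr (- ((3 + 4 * r) / (1 + 2 * r))))"
      using D by (intro mult_left_mono moment_tail_rate r_pos N q resolution_le j) auto
    \<comment> \<open>splitting \<open>1 / (n * m)\<close> exposes the factor \<open>1 / n\<close> that vanishes\<close>
    also have "\<dots> = D / real n * (1 / real m * ?N powr (- ((3 + 4 * r) / (1 + 2 * r))))"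
      by simp
    finally show "measure (sample_law MX K f m n)
         {\<omega> \<in> space (sample_law MX K f m n). \<bar>local_est h \<psi> n k j l \<omega>\<bar> > sqrt ?N}
       \<le> D / real n * (1 / real m * ?N powr (- ((3 + 4 * r) / (1 + 2 * r))))" .
  qed

  show ?thesis
  proof (rule exI[of _ "1 + B"], intro conjI allI impI ballI, goal_cases)
    case 1
    show ?case using B by linarith
  next
    case (2 m n f z)
    obtain k j l where z: "z = (k, j, l)" by (cases z)
    show ?case unfolding z prod.case by (rule main) (use 2 z in auto)
  next
    case (3 m \<epsilon>)
    then have m: "1 \<le> m n" and \<epsilon>: "0 < \<epsilon>" for n by auto
    show "\<forall>\<^sub>F n in sequentially. \<forall>f\<in>\<F>. \<forall>(k, j, l) \<in> est_index J r (m n) n.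
       measure (sample_law MX K f (m n) n)
         {\<omega> \<in> space (sample_law MX K f (m n) n).
            \<bar>local_est h \<psi> n k j l \<omega>\<bar> > sqrt (real (n * m n))}
       \<le> \<epsilon> * (1 / real (m n) * real (n * m n) powr (- ((3 + 4 * r) / (1 + 2 * r))))"
      \<comment> \<open>this threshold depends neither on \<open>m\<close> nor on \<open>f\<close> or the index\<close>
      using eventually_ge_at_top[of "1 + nat \<lceil>D / \<epsilon>\<rceil>"]
    proof eventually_elim
      case (elim n)
      then have n: "1 \<le> n" and "D / \<epsilon> \<le> real n" by linarith+
      then have "D / real n \<le> \<epsilon>" using \<epsilon> by (simp add: field_simps)
      then have "D / real n * (1 / real (m n) * x powr y) \<le> \<epsilon> * (1 / real (m n) * x powr y)"
        for x y by (rule mult_right_mono) simp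
      note le = order_trans[OF tail[OF m n] this]
      show ?case
      proof (intro ballI, goal_cases)
        case (1 f z)
        obtain k j l where z: "z = (k, j, l)" by (cases z)
        show ?case unfolding z prod.case by (rule le) (use 1 z in auto)
      qed
    qed
  qed
qed

end
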